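(* Let $\{p_\theta\}_{\theta\in\Theta}$, $\Theta\subset\mathbb{R}^d$ convex, be an exponential family of density/mass functions $p_\theta(x)=\exp\left(\langle\theta,T(x)\rangle-A(\theta)\right)h(x)$ with sufficient statistic $T$, log-partition $A$ and reference function $h$. Let $\theta\in\Theta$, let $Y\sim p_\theta$, and let $\hat\theta$ be a random vector with values in $\Theta$ (the estimated natural parameter), independent of $Y$, such that all expectations below exist. Then $$\mathbb{E}\left[-\ln p_{\hat\theta}(Y)\right]=n(\theta)+\mathbb{B}_A\left[\hat\theta\right]+d_A\left(\theta,\mathbb{E}[\hat\theta]\right),$$ where $n(\theta)=-A^*\left(\nabla A(\theta)\right)-\mathbb{E}\left[\ln h(Y)\right]$.
   Context: Densities/mass functions are with respect to a common base measure $\mu$ (Lebesgue or counting measure). The log-partition $A\colon\Theta\to\mathbb{R}$ is the normalizing function $A(\theta)=\ln\int\exp(\langle\theta,T\rangle)h\,\mathrm{d}\mu$; as usual for exponential families, it is taken to be differentiable and strictly convex on $\Theta$ with $\mathbb{E}[T(X)]=\nabla A(\theta)$ for $X\sim p_\theta$. $A^*(u)=\sup_{\theta\in\Theta}\left(\langle u,\theta\rangle-A(\theta)\right)$ is the convex conjugate. The Bregman divergence generated by $A$ is $d_A(x,y)=A(y)-A(x)-\langle\nabla A(x),y-x\rangle$, and the Bregman Information of a $\Theta$-valued random vector $X$ is $\mathbb{B}_A[X]=\mathbb{E}\left[d_A(\mathbb{E}[X],X)\right]=\mathbb{E}[A(X)]-A(\mathbb{E}[X])$. "All expectations exist" means that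 $\mathbb{E}[\hat\theta]$, $\mathbb{E}[A(\hat\theta)]$, $\mathbb{E}[T(Y)]$ and $\mathbb{E}[\ln h(Y)]$ exist and are finite. *)

theory Defs
  imports "HOL-Probability.Probability"
begin

text \<open>
  An exponential family is given by a base measure \<open>\<mu>\<close> (Lebesgue and counting measures are the
  intended instances, but any measure is allowed), a sufficient statistic \<open>T\<close>, a reference
  function \<open>h\<close>, and a parameter set \<open>\<Theta>\<close> in a Euclidean space.
\<close>

definition log_partition ::
    "'x measure \<Rightarrow> ('x \<Rightarrow> 'a::euclidean_space) \<Rightarrow> ('x \<Rightarrow> real) \<Rightarrow> 'a \<Rightarrow> real" where
  "log_partition \<mu> T h \<theta> = ln (\<integral>x. exp (\<theta> \<bullet> T x) * h x \<partial>\<mu>)"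

definition expfam_density ::
    "'x measure \<Rightarrow> ('x \<Rightarrow> 'a::euclidean_space) \<Rightarrow> ('x \<Rightarrow> real) \<Rightarrow> 'a \<Rightarrow> 'x \<Rightarrow> real" where
  "expfam_density \<mu> T h \<theta> x = exp (\<theta> \<bullet> T x - log_partition \<mu> T h \<theta>) * h x"

text \<open>
  The last condition says that the normalizing integral lies strictly between \<open>0\<close> and \<open>\<infinity>\<close>, so
  that \<^const>\<open>log_partition\<close> is a genuine real-valued function on \<open>\<Theta>\<close>.
\<close>

definition exponential_family ::
    "'x measure \<Rightarrow> ('x \<Rightarrow> 'a::euclidean_space) \<Rightarrow> ('x \<Rightarrow> real) \<Rightarrow> 'a set \<Rightarrow> bool" where
  "exponential_family \<mu> T h \<Theta> \<longleftrightarrow>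
     convex \<Theta> \<and> T \<in> borel_measurable \<mu> \<and> h \<in> borel_measurable \<mu> \<and>
     (\<forall>x\<in>space \<mu>. 0 \<le> h x) \<and>
     (\<forall>\<theta>\<in>\<Theta>. integrable \<mu> (\<lambda>x. exp (\<theta> \<bullet> T x) * h x) \<and>
             0 < (\<integral>x. exp (\<theta> \<bullet> T x) * h x \<partial>\<mu>))"

definition strictly_convex_on :: "'a::real_vector set \<Rightarrow> ('a \<Rightarrow> real) \<Rightarrow> bool" where
  "strictly_convex_on S f \<longleftrightarrow>
     (\<forall>x\<in>S. \<forall>y\<in>S. \<forall>t. x \<noteq> y \<longrightarrow> 0 < t \<longrightarrow> t < 1 \<longrightarrow>
        f ((1 - t) *\<^sub>R x + t *\<^sub>R y) < (1 - t) * f x + t * f y)"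

text \<open>
  \<open>G\<close> is a gradient field of \<open>f\<close> on \<open>S\<close>. The derivative is taken within \<open>S\<close>, since \<open>S\<close> need not be
  open; at interior points of \<open>S\<close> this is the usual gradient.
\<close>

definition gradient_on :: "'a::real_inner set \<Rightarrow> ('a \<Rightarrow> real) \<Rightarrow> ('a \<Rightarrow> 'a) \<Rightarrow> bool" where
  "gradient_on S f G \<longleftrightarrow> (\<forall>x\<in>S. (f has_derivative (\<lambda>v. G x \<bullet> v)) (at x within S))"

text \<open>The supremum is extended-real, so no boundedness is presupposed.\<close>

definition convex_conjugate :: "'a::real_inner set \<Rightarrow> ('a \<Rightarrow> real) \<Rightarrow> 'a \<Rightarrow> ereal" where
  "convex_conjugate S f u = (SUP x\<in>S. ereal (u \<bullet> x - f x))"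

text \<open>In the next two definitions \<open>G\<close> plays the role of the gradient of \<open>f\<close>.\<close>

definition bregman_divergence ::
    "('a::real_inner \<Rightarrow> real) \<Rightarrow> ('a \<Rightarrow> 'a) \<Rightarrow> 'a \<Rightarrow> 'a \<Rightarrow> real" where
  "bregman_divergence f G x y = f y - f x - G x \<bullet> (y - x)"

definition bregman_information ::
    "'w measure \<Rightarrow> ('a::euclidean_space \<Rightarrow> real) \<Rightarrow> ('a \<Rightarrow> 'a) \<Rightarrow> ('w \<Rightarrow> 'a) \<Rightarrow> real" where
  "bregman_information M f G X = (\<integral>\<omega>. bregman_divergence f G (\<integral>\<omega>'. X \<omega>' \<partial>M) (X \<omega>) \<partial>M)"

text \<open>
  The library's \<^const>\<open>prob_space.indep_var\<close> forces both random variables to have the same value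
  type; this is the same notion (independence of the generated \<open>\<sigma>\<close>-algebras) for two value types.
\<close>

definition indep_rvs ::
    "'w measure \<Rightarrow> 'b measure \<Rightarrow> ('w \<Rightarrow> 'b) \<Rightarrow> 'c measure \<Rightarrow> ('w \<Rightarrow> 'c) \<Rightarrow> bool" where
  "indep_rvs M N X N' Y \<longleftrightarrow>
     X \<in> measurable M N \<and> Y \<in> measurable M N' \<and>
     prob_space.indep_set M {X -` B \<inter> space M |B. B \<in> sets N} {Y -` C \<inter> space M |C. C \<in> sets N'}"

end

theory Submission
  imports Defs
begin

text \<open>
  Almost surely \<open>-ln p\<^bsub>\<theta>hat\<^esub>(Y) = A(\<theta>hat) - \<langle>\<theta>hat, T(Y)\<rangle> - ln h(Y)\<close>. By independence the middle term has
  expectation \<open>\<langle>E \<theta>hat, \<nabla>A(\<theta>)\<rangle>\<close>, and by convexity the supremum defining \<open>A\<^sup>*(\<nabla>A(\<theta>))\<close> is attained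
  at \<open>\<theta>\<close> (Fenchel--Young equality). What remains is a linear identity, since the gradient term in the
  Bregman information is paired with a centred vector and vanishes in expectation.
\<close>

text \<open>Along the segment from \<open>x\<close> to \<open>y\<close>, convexity bounds every
  difference quotient at 0 by \<open>f y - f x\<close>. The one-sided limit of these quotients is
  the directional derivative \<open>G x \<bullet> (y - x)\<close>.\<close>

lemma convex_gradient_inequality:
  fixes f :: "'a::real_inner \<Rightarrow> real"
  assumes S: "convex S" "x \<in> S" "y \<in> S"
    and f: "strictly_convex_on S f" "gradient_on S f G"
  shows "f x + G x \<bullet> (y - x) \<le> f y"
proof -
  define c where "c = (\<lambda>t::real. x + t *\<^sub>R (y - x))"
  have c_eq: "c t = (1 - t) *\<^sub>R x + t *\<^sub>R y" for t
    by (simp add: c_def algebra_simps)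
  have c_S: "c ` {0..1} \<subseteq> S"
    using S by (auto simp: c_eq convex_alt)
  \<comment> \<open>\<open>gradient_on\<close> differentiates only within \<open>S\<close>, so the
    chain rule is applied within the image of the segment, which lies in \<open>S\<close>.\<close>
  have "(f has_derivative (\<lambda>v. G x \<bullet> v)) (at (c 0) within c ` {0..1})"
    using f(2) S(2) c_S by (auto simp: gradient_on_def c_def intro: has_derivative_subset)
  moreover have "(c has_vector_derivative (y - x)) (at 0 within {0..1})"
    unfolding c_def by (auto intro!: derivative_eq_intros)
  ultimately have "((f \<circ> c) has_derivative (\<lambda>t. G x \<bullet> (t *\<^sub>R (y - x)))) (at 0 within {0..1})"
    unfolding has_vector_derivative_def by (auto dest: diff_chain_within simp: o_def)
  then have "((f \<circ> c) has_field_derivative G x \<bullet> (y - x)) (at 0 within {0..1})"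
    by (simp add: has_field_derivative_def mult_commute_abs)
  then have lim: "((\<lambda>t. (f (c t) - f x) / t) \<longlongrightarrow> G x \<bullet> (y - x)) (at 0 within {0..1})"
    by (simp add: has_field_derivative_iff c_def)
  \<comment> \<open>Strict convexity is silent for equal points and for \<open>t = 1\<close>; there
    both sides agree.\<close>
  have "f (c t) - f x \<le> t * (f y - f x)" if "0 < t" "t \<le> 1" for t
  proof (cases "x = y \<or> t = 1")
    case False
    then have "f (c t) < (1 - t) * f x + t * f y"
      using f(1) S that by (auto simp: strictly_convex_on_def c_eq)
    then show ?thesis by (simp add: algebra_simps)
  qed (auto simp: c_def)
  then have "eventually (\<lambda>t. (f (c t) - f x) / t \<le> f y - f x) (at 0 within {0..1})"
    by (auto simp: eventually_at_filter divide_le_eq mult.commute intro!: always_eventually)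
  \<comment> \<open>The bound passes to the limit because the filter is \<open>at_right 0\<close>,
    which is nontrivial.\<close>
  then have "G x \<bullet> (y - x) \<le> f y - f x"
    using lim by (intro tendsto_upperbound) (auto simp: at_within_Icc_at_right)
  then show ?thesis by simp
qed

text \<open>The gradient inequality, rearranged, bounds every term of the supremum by the term at
  \<open>x\<close>. In particular the extended-real conjugate is finite here.\<close>

lemma convex_conjugate_gradient:
  fixes f :: "'a::real_inner \<Rightarrow> real"
  assumes "convex S" "x \<in> S" "strictly_convex_on S f" "gradient_on S f G"
  shows "convex_conjugate S f (G x) = ereal (G x \<bullet> x - f x)"
  unfolding convex_conjugate_def
proof (rule antisym)
  show "(SUP y\<in>S. ereal (G x \<bullet> y - f y)) \<le> ereal (G x \<bullet> x - f x)"
    using convex_gradient_inequality[OF assms(1,2) _ assms(3,4)]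
    by (intro SUP_least) (simp add: inner_diff_right algebra_simps)
qed (use assms(2) in \<open>auto intro: SUP_upper\<close>)

text \<open>Composition can only shrink the generated \<sigma>-algebras, so independence is
  inherited. Mapping both variables into one value type makes \<open>indep_var\<close>
  applicable.\<close>

lemma indep_rvs_compose:
  assumes "prob_space M" and ind: "indep_rvs M N X N' Y"
    and f: "f \<in> measurable N L" and g: "g \<in> measurable N' L'"
  shows "prob_space.indep_var M L (\<lambda>\<omega>. f (X \<omega>)) L' (\<lambda>\<omega>. g (Y \<omega>))"
proof -
  interpret prob_space M by fact
  have X: "X \<in> measurable M N" and Y: "Y \<in> measurable M N'"
    and indep: "indep_set {X -` B \<inter> space M |B. B \<in> sets N} {Y -` C \<inter> space M |C. C \<in> sets N'}"
    using ind by (auto simp: indep_rvs_def)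
  \<comment> \<open>The preimages under \<open>Z\<close> already form a \<sigma>-algebra, so it
    suffices to place the generators in it.\<close>
  have sub: "sigma_sets (space M) {(\<lambda>\<omega>. k (Z \<omega>)) -` B \<inter> space M |B. B \<in> sets P}
      \<subseteq> {Z -` B \<inter> space M |B. B \<in> sets Q}"
    if "Z \<in> measurable M Q" "k \<in> measurable Q P" for Z k P Q
  proof -
    have "(\<lambda>\<omega>. k (Z \<omega>)) -` B \<inter> space M = Z -` (k -` B \<inter> space Q) \<inter> space M" for B
      using measurable_space[OF that(1)] by auto
    then have "{(\<lambda>\<omega>. k (Z \<omega>)) -` B \<inter> space M |B. B \<in> sets P} \<subseteq> sets (vimage_algebra (space M) Z Q)"
      using measurable_sets[OF that(2)] by (auto simp del: vimage_Int intro: in_vimage_algebra)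
    from sets.sigma_sets_subset[OF this] show ?thesis
      using measurable_space[OF that(1)] by (simp add: sets_vimage_algebra2 Pi_I)
  qed
  have "indep_set (sigma_sets (space M) {(\<lambda>\<omega>. f (X \<omega>)) -` B \<inter> space M |B. B \<in> sets L})
     (sigma_sets (space M) {(\<lambda>\<omega>. g (Y \<omega>)) -` C \<inter> space M |C. C \<in> sets L'})"
    unfolding indep_sets2_eq
  proof (intro conjI ballI)
    note ind = indep[unfolded indep_sets2_eq]
    show "sigma_sets (space M) {(\<lambda>\<omega>. f (X \<omega>)) -` B \<inter> space M |B. B \<in> sets L} \<subseteq> events"
      using sub[OF X f] conjunct1[OF ind] by (rule subset_trans)
    show "sigma_sets (space M) {(\<lambda>\<omega>. g (Y \<omega>)) -` C \<inter> space M |C. C \<in> sets L'} \<subseteq> events"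
      using sub[OF Y g] conjunct1[OF conjunct2[OF ind]] by (rule subset_trans)
  next
    fix a b
    assume "a \<in> sigma_sets (space M) {(\<lambda>\<omega>. f (X \<omega>)) -` B \<inter> space M |B. B \<in> sets L}"
      "b \<in> sigma_sets (space M) {(\<lambda>\<omega>. g (Y \<omega>)) -` C \<inter> space M |C. C \<in> sets L'}"
    from subsetD[OF sub[OF X f] this(1)] subsetD[OF sub[OF Y g] this(2)]
    show "prob (a \<inter> b) = prob a * prob b"
      by (rule indep[unfolded indep_sets2_eq, THEN conjunct2, THEN conjunct2, rule_format])
  qed
  then show ?thesis
    unfolding indep_var_eq using measurable_compose[OF X f] measurable_compose[OF Y g] by blast
qed

text \<open>In coordinates the inner product is a finite sum of products of independent integrable
  real variables. Each product is integrable and its expectation factors.\<close>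

lemma indep_rvs_inner:
  fixes X :: "'w \<Rightarrow> 'a::euclidean_space" and g :: "'b \<Rightarrow> 'a"
  assumes "prob_space M" and ind: "indep_rvs M borel X N Y" and g: "g \<in> borel_measurable N"
    and X: "integrable M X" and Y: "integrable M (\<lambda>\<omega>. g (Y \<omega>))"
  shows "integrable M (\<lambda>\<omega>. X \<omega> \<bullet> g (Y \<omega>))"
    and "(\<integral>\<omega>. X \<omega> \<bullet> g (Y \<omega>) \<partial>M) = (\<integral>\<omega>. X \<omega> \<partial>M) \<bullet> (\<integral>\<omega>. g (Y \<omega>) \<partial>M)"
proof -
  interpret prob_space M by fact
  have iv: "indep_var borel (\<lambda>\<omega>. X \<omega> \<bullet> b) borel (\<lambda>\<omega>. g (Y \<omega>) \<bullet> b)" for b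
    using g by (auto intro!: indep_rvs_compose[OF assms(1) ind, of "\<lambda>x. x \<bullet> b" borel])
  have int: "integrable M (\<lambda>\<omega>. (X \<omega> \<bullet> b) * (g (Y \<omega>) \<bullet> b))"
    and eq: "(\<integral>\<omega>. (X \<omega> \<bullet> b) * (g (Y \<omega>) \<bullet> b) \<partial>M)
      = ((\<integral>\<omega>. X \<omega> \<partial>M) \<bullet> b) * ((\<integral>\<omega>. g (Y \<omega>) \<partial>M) \<bullet> b)" for b
    using indep_var_integrable[OF iv] indep_var_lebesgue_integral[OF iv] X Y by auto
  have sum: "X \<omega> \<bullet> g (Y \<omega>) = (\<Sum>b\<in>Basis. (X \<omega> \<bullet> b) * (g (Y \<omega>) \<bullet> b))" for \<omega>
    by (rule euclidean_inner)
  show "integrable M (\<lambda>\<omega>. X \<omega> \<bullet> g (Y \<omega>))"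
    unfolding sum using int by (intro Bochner_Integration.integrable_sum)
  have "(\<integral>\<omega>. X \<omega> \<bullet> g (Y \<omega>) \<partial>M) = (\<Sum>b\<in>Basis. \<integral>\<omega>. (X \<omega> \<bullet> b) * (g (Y \<omega>) \<bullet> b) \<partial>M)"
    unfolding sum using int by (intro Bochner_Integration.integral_sum)
  also have "\<dots> = (\<integral>\<omega>. X \<omega> \<partial>M) \<bullet> (\<integral>\<omega>. g (Y \<omega>) \<partial>M)"
    unfolding eq by (rule euclidean_inner[symmetric])
  finally show "(\<integral>\<omega>. X \<omega> \<bullet> g (Y \<omega>) \<partial>M) = (\<integral>\<omega>. X \<omega> \<partial>M) \<bullet> (\<integral>\<omega>. g (Y \<omega>) \<partial>M)" .
qed

lemma bregman_information_eq:
  assumes "prob_space M" "integrable M X" "integrable M (\<lambda>\<omega>. f (X \<omega>))"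
  shows "bregman_information M f G X = (\<integral>\<omega>. f (X \<omega>) \<partial>M) - f (\<integral>\<omega>. X \<omega> \<partial>M)"
proof -
  interpret prob_space M by fact
  show ?thesis
    using assms(2,3)
    by (simp add: bregman_information_def bregman_divergence_def prob_space)
qed

text \<open>The law of \<open>Y\<close> gives no mass to the zero set of its own density. This is
  what makes \<open>h (Y \<omega>)\<close> positive almost surely.\<close>

lemma distributed_AE_pos:
  fixes f :: "'b \<Rightarrow> ennreal"
  assumes "distributed M N Y f"
  shows "AE \<omega> in M. 0 < f (Y \<omega>)"
proof -
  have f[measurable]: "f \<in> borel_measurable N" and Y: "Y \<in> measurable M N"
    and d: "distr M N Y = density N f"
    using assms by (auto simp: distributed_def)
  have "AE x in distr M N Y. 0 < f x"
    unfolding d by (simp add: AE_density)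
  then show ?thesis
    using Y by (simp add: AE_distr_iff)
qed

theorem proposition3p4:
  fixes \<mu> :: "'x measure" and T :: "'x \<Rightarrow> 'a::euclidean_space" and h :: "'x \<Rightarrow> real"
    and \<Theta> :: "'a set" and A :: "'a \<Rightarrow> real" and p :: "'a \<Rightarrow> 'x \<Rightarrow> real" and gradA :: "'a \<Rightarrow> 'a"
    and M :: "'w measure" and Y :: "'w \<Rightarrow> 'x" and \<theta>hat :: "'w \<Rightarrow> 'a" and \<theta> :: 'a
  defines "A \<equiv> log_partition \<mu> T h"
    and "p \<equiv> expfam_density \<mu> T h"
  assumes family: "exponential_family \<mu> T h \<Theta>"
    and A_convex: "strictly_convex_on \<Theta> A"
    and A_gradient: "gradient_on \<Theta> A gradA"
    and mean: "\<And>\<theta>'. \<theta>' \<in> \<Theta> \<Longrightarrow>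
      has_bochner_integral (density \<mu> (\<lambda>x. ennreal (p \<theta>' x))) T (gradA \<theta>')"
    and prob: "prob_space M"
    and \<theta>_mem: "\<theta> \<in> \<Theta>"
    and Y_distr: "distributed M \<mu> Y (\<lambda>x. ennreal (p \<theta> x))"
    and \<theta>hat_rv: "\<theta>hat \<in> borel_measurable M"
    and \<theta>hat_mem: "\<And>\<omega>. \<omega> \<in> space M \<Longrightarrow> \<theta>hat \<omega> \<in> \<Theta>"
    and indep: "indep_rvs M borel \<theta>hat \<mu> Y"
    and int_\<theta>hat: "integrable M \<theta>hat"
    and int_A: "integrable M (\<lambda>\<omega>. A (\<theta>hat \<omega>))"
    and int_T: "integrable M (\<lambda>\<omega>. T (Y \<omega>))"
    and int_ln_h: "integrable M (\<lambda>\<omega>. ln (h (Y \<omega>)))"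
  shows "integrable M (\<lambda>\<omega>. - ln (p (\<theta>hat \<omega>) (Y \<omega>))) \<and>
    ereal (\<integral>\<omega>. - ln (p (\<theta>hat \<omega>) (Y \<omega>)) \<partial>M) =
      (- convex_conjugate \<Theta> A (gradA \<theta>) - ereal (\<integral>\<omega>. ln (h (Y \<omega>)) \<partial>M))
      + ereal (bregman_information M A gradA \<theta>hat)
      + ereal (bregman_divergence A gradA \<theta> (\<integral>\<omega>. \<theta>hat \<omega> \<partial>M))"
proof -
  interpret prob_space M by fact
  note fam = family[unfolded exponential_family_def]
  have T: "T \<in> borel_measurable \<mu>" and cvx: "convex \<Theta>" using fam by auto
  have Y: "Y \<in> measurable M \<mu>" and dY: "distr M \<mu> Y = density \<mu> (\<lambda>x. ennreal (p \<theta> x))"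
    using Y_distr by (auto simp: distributed_def)
  let ?m = "\<integral>\<omega>. \<theta>hat \<omega> \<partial>M" and ?g = "gradA \<theta>" and ?lh = "\<integral>\<omega>. ln (h (Y \<omega>)) \<partial>M"
  \<comment> \<open>\<open>mean\<close> speaks of the measure with density
    \<open>p \<theta>\<close>, which is the law of \<open>Y\<close>; a change of variables carries
    it to \<open>M\<close>.\<close>
  have ET: "(\<integral>\<omega>. T (Y \<omega>) \<partial>M) = ?g"
    using integral_distr[OF Y T] has_bochner_integral_integral_eq[OF mean[OF \<theta>_mem]] dY by simp
  note inn = indep_rvs_inner[OF prob indep T int_\<theta>hat int_T, unfolded ET]
  let ?F = "\<lambda>\<omega>. A (\<theta>hat \<omega>) - \<theta>hat \<omega> \<bullet> T (Y \<omega>) - ln (h (Y \<omega>))"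
  \<comment> \<open>The identity can fail where \<open>h (Y \<omega>) = 0\<close>, since there
    \<open>ln 0 = 0\<close> makes the left side 0 and leaves \<open>A (\<theta>hat \<omega>) -
    \<theta>hat \<omega> \<bullet> T (Y \<omega>)\<close> on the right.\<close>
  have ae: "AE \<omega> in M. - ln (p (\<theta>hat \<omega>) (Y \<omega>)) = ?F \<omega>"
    using distributed_AE_pos[OF Y_distr]
  proof eventually_elim
    case (elim \<omega>)
    then have "0 < h (Y \<omega>)"
      by (simp add: p_def expfam_density_def zero_less_mult_iff)
    then show ?case
      by (simp add: p_def A_def expfam_density_def ln_mult)
  qed
  have intF: "integrable M ?F" using int_A inn(1) int_ln_h by auto
  have EF: "(\<integral>\<omega>. ?F \<omega> \<partial>M) = (\<integral>\<omega>. A (\<theta>hat \<omega>) \<partial>M) - ?m \<bullet> ?g - ?lh"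
    using int_A inn int_ln_h by simp
  have A_meas: "(\<lambda>\<omega>. A (\<theta>hat \<omega>)) \<in> borel_measurable M" using int_A by auto
  have T_meas: "(\<lambda>\<omega>. T (Y \<omega>)) \<in> borel_measurable M" using int_T by auto
  have hY: "(\<lambda>\<omega>. h (Y \<omega>)) \<in> borel_measurable M"
    using fam measurable_compose[OF Y] by auto
  \<comment> \<open>Folding the log-partition back into \<open>A\<close> lets the composite
    \<open>A (\<theta>hat \<omega>)\<close> be measurable by its integrability, without an argument
    about \<open>A\<close> itself.\<close>
  have meas: "(\<lambda>\<omega>. - ln (p (\<theta>hat \<omega>) (Y \<omega>))) \<in> borel_measurable M"
    unfolding p_def expfam_density_def A_def[symmetric]
    using A_meas T_meas hY \<theta>hat_rv by measurable
  have "integrable M (\<lambda>\<omega>. - ln (p (\<theta>hat \<omega>) (Y \<omega>)))"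
    using intF integrable_cong_AE[OF meas borel_measurable_integrable[OF intF] ae] by simp
  moreover have "(\<integral>\<omega>. - ln (p (\<theta>hat \<omega>) (Y \<omega>)) \<partial>M)
      = (\<integral>\<omega>. A (\<theta>hat \<omega>) \<partial>M) - ?m \<bullet> ?g - ?lh"
    using integral_cong_AE[OF meas borel_measurable_integrable[OF intF] ae] EF by simp
  \<comment> \<open>With the conjugate finite, this is real arithmetic: \<open>A ?m\<close> cancels
    between the Bregman information and the divergence, while \<open>A \<theta>\<close> and
    \<open>?g \<bullet> \<theta>\<close> cancel between the divergence and the conjugate.\<close>
  ultimately show ?thesis
    by (simp add: convex_conjugate_gradient[OF cvx \<theta>_mem A_convex A_gradient]
        bregman_information_eq[OF prob int_\<theta>hat int_A] bregman_divergence_def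
        inner_diff_right inner_commute)
qed

end
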